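(* Let $D=(V,A)$ be a digraph, $k\ge 2$ an integer and $F\subseteq A$ such that $\lambda(D)\le \lfloor\frac{k+1}{2}\rfloor$ and the digraph obtained from $D$ by reversing the arcs of $F$ is $k$-arc-connected. Then there exists an arc $\vec a=uv$ of $F$ such that $\lambda(D)\le\lambda(D')$, where $D'$ is the digraph obtained from $D$ by reversing $\vec a$, i.e. replacing the arc $uv$ by the arc $vu$.
   Context: For a digraph $D=(V,A)$, $\lambda(D)=\min\{d_A^-(X): \emptyset\neq X\subsetneq V\}$ denotes its arc-connectivity, where $d_A^-(X)$ is the number of arcs of $A$ entering $X$; $D$ is $k$-arc-connected if $\lambda(D)\ge k$. Reversing an arc $uv$ means replacing it by the arc $vu$. *)

theory Defs
  imports "Graph_Theory.Digraph" "HOL-Library.Extended_Nat"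
begin

text \<open>
  Digraphs are the records of type \<open>('a, 'b) pre_digraph\<close>, in which arcs have an identity
  of their own. Parallel arcs are thus allowed: reversing an arc \<open>uv\<close> in the presence of an
  arc \<open>vu\<close> yields two parallel arcs, which are counted separately.
\<close>

definition entering_arcs :: "('a, 'b) pre_digraph \<Rightarrow> 'a set \<Rightarrow> 'b set" where
  "entering_arcs D X = {e \<in> arcs D. tail D e \<notin> X \<and> head D e \<in> X}"

definition set_in_degree :: "('a, 'b) pre_digraph \<Rightarrow> 'a set \<Rightarrow> nat" where
  "set_in_degree D X = card (entering_arcs D X)"

text \<open>
  Values are taken in \<open>enat\<close> so that the minimum over the empty family (at most one vertex)
  is \<open>\<infinity>\<close>. In all other cases the infimum is attained, hence is a minimum.
\<close>
definition arc_connectivity :: "('a, 'b) pre_digraph \<Rightarrow> enat" where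
  "arc_connectivity D = (INF X \<in> {X. X \<noteq> {} \<and> X \<subset> verts D}. enat (set_in_degree D X))"

definition arc_connected :: "nat \<Rightarrow> ('a, 'b) pre_digraph \<Rightarrow> bool" where
  "arc_connected k D \<longleftrightarrow> enat k \<le> arc_connectivity D"

definition reverse_arcs :: "('a, 'b) pre_digraph \<Rightarrow> 'b set \<Rightarrow> ('a, 'b) pre_digraph" where
  "reverse_arcs D F = D\<lparr>tail := (\<lambda>e. if e \<in> F then head D e else tail D e),
                        head := (\<lambda>e. if e \<in> F then tail D e else head D e)\<rparr>"

end

theory Submission
  imports Defs "HOL-Library.Disjoint_Sets"
begin

text \<open>
  Write \<open>l = \<lambda>(D)\<close>, \<open>g = k - l\<close>, and call a set tight if its in-degree is \<open>l\<close>. If every reversal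
  decreases \<open>\<lambda>\<close>, then every arc of \<open>F\<close> enters a tight set, while every tight set is left by at
  least \<open>g\<close> more arcs of \<open>F\<close> than enter it. Tight sets can be uncrossed, so if an \<open>F\<close>-arc leaves
  a tight set \<open>X\<close> and enters a tight set \<open>Z\<close>, then \<open>X \<inter> Z = {}\<close> or \<open>X \<union> Z = V\<close>. Were the second
  alternative impossible, then all \<open>F\<close>-arcs leaving a member of a suitable family of disjoint
  tight sets would enter another member; the union of the family would be left by no \<open>F\<close>-arc,
  contradicting \<open>g > 0\<close>.

  In the second alternative \<open>U = V - Z\<close> is a set of out-degree \<open>l\<close> inside \<open>X\<close>, and the arc leaves
  both. For the smallest such \<open>X\<close> (or smallest dual \<open>X\<close>), some union of \<open>r\<close> disjoint sets of
  out-degree \<open>l\<close> in \<open>X\<close> is entered by \<open>F\<close>-arcs from outside \<open>X\<close> only. As it sends at least one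
  \<open>F\<close>-arc out of \<open>X\<close>, at least \<open>r g + 1\<close> arcs of \<open>F\<close> enter \<open>X\<close>; but only \<open>l \<le> g + 1\<close> arcs do. Hence
  \<open>r = 1\<close>, and then the cut \<open>X - U\<close> has too few entering arcs.
\<close>

section \<open>Counting identities for in-degrees\<close>

definition indeg :: "'b set \<Rightarrow> ('b \<Rightarrow> 'a) \<Rightarrow> ('b \<Rightarrow> 'a) \<Rightarrow> 'a set \<Rightarrow> nat" where
  "indeg A t h S = card {e \<in> A. t e \<notin> S \<and> h e \<in> S}"

lemma card_filter_eq_sum:
  "finite A \<Longrightarrow> card {e \<in> A. P e} = (\<Sum>e\<in>A. of_bool (P e))"
  by (simp add: sum_of_bool_eq Int_def)

lemma indeg_pos_iff:
  "finite A \<Longrightarrow> 0 < indeg A t h S \<longleftrightarrow> (\<exists>e\<in>A. t e \<notin> S \<and> h e \<in> S)"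
  by (auto simp: indeg_def card_gt_0_iff)

lemma indeg_Int_Un:
  assumes "finite A"
  shows "indeg A t h X + indeg A t h Y = indeg A t h (X \<inter> Y) + indeg A t h (X \<union> Y)
    + card {e \<in> A. t e \<in> X - Y \<and> h e \<in> Y - X \<or> t e \<in> Y - X \<and> h e \<in> X - Y}"
  unfolding indeg_def card_filter_eq_sum[OF assms] sum.distrib[symmetric]
  by (rule sum.cong) auto

text \<open>Submodularity for \<open>X\<close> and the complement of \<open>U\<close>: since
  \<open>U\<close> lies in \<open>X\<close>, their union is everything and no arc enters it.\<close>

lemma indeg_Diff:
  assumes "finite A" and "U \<subseteq> X"
  shows "indeg A t h X + indeg A h t U = indeg A t h (X - U)
    + card {e \<in> A. t e \<notin> X \<and> h e \<in> U} + card {e \<in> A. t e \<in> U \<and> h e \<notin> X}"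
  unfolding indeg_def card_filter_eq_sum[OF assms(1)] sum.distrib[symmetric]
  using assms(2) by (intro sum.cong) auto

text \<open>Arcs between \<open>S\<close> and \<open>T\<close> cancel in the difference of in- and
  out-degree, which is thus additive; stated without subtraction on naturals.\<close>

lemma indeg_disjoint_Un:
  assumes "finite A" and "S \<inter> T = {}"
  shows "indeg A t h (S \<union> T) + indeg A h t S + indeg A h t T
    = indeg A h t (S \<union> T) + indeg A t h S + indeg A t h T"
  unfolding indeg_def card_filter_eq_sum[OF assms(1)] sum.distrib[symmetric]
  using assms(2) by (intro sum.cong) auto

lemma indeg_Union_surplus:
  assumes "finite A" and "finite R" and "disjoint R"
    and "\<And>S. S \<in> R \<Longrightarrow> indeg A h t S + g \<le> indeg A t h S"
  shows "indeg A h t (\<Union>R) + card R * g \<le> indeg A t h (\<Union>R)"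
  using assms(2-)
proof (induction R rule: finite_induct)
  case empty
  then show ?case by (simp add: indeg_def)
next
  case (insert S R)
  have "S \<inter> \<Union>R = {}"
    using insert.prems(1) insert.hyps(2) by (fastforce simp: disjoint_def)
  note indeg_disjoint_Un[OF assms(1) this, of t h]
  moreover have "indeg A h t (\<Union>R) + card R * g \<le> indeg A t h (\<Union>R)"
    using insert by (auto simp: disjoint_def)
  moreover have "indeg A h t S + g \<le> indeg A t h S"
    using insert.prems(2) by blast
  ultimately show ?case using insert.hyps by simp
qed

section \<open>Disjoint maximal members of set families\<close>

definition maximal_sets :: "'a set set \<Rightarrow> 'a set set" where
  "maximal_sets T = {S \<in> T. \<forall>S'\<in>T. S \<subseteq> S' \<longrightarrow> S' = S}"

lemma maximal_sets_exist:
  assumes "finite T" and "S \<in> T"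
  shows "\<exists>M\<in>maximal_sets T. S \<subseteq> M"
  using finite_has_maximal2[OF assms] by (auto simp: maximal_sets_def)

lemma maximal_sets_disjoint:
  assumes "\<And>S S'. S \<in> T \<Longrightarrow> S' \<in> T \<Longrightarrow> S \<inter> S' \<noteq> {} \<Longrightarrow> S \<union> S' \<in> T"
  shows "disjoint (maximal_sets T)"
proof (rule disjointI)
  fix S S' assume *: "S \<in> maximal_sets T" "S' \<in> maximal_sets T" "S \<noteq> S'"
  show "S \<inter> S' = {}"
  proof (rule ccontr)
    assume "S \<inter> S' \<noteq> {}"
    then have "S \<union> S' \<in> T" using * assms by (auto simp: maximal_sets_def)
    then have "S \<union> S' = S" "S \<union> S' = S'"
      using * by (auto simp: maximal_sets_def)
    then show False using * by simp
  qed
qed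

section \<open>Tight sets and uncrossing\<close>

definition tight :: "'a set \<Rightarrow> 'b set \<Rightarrow> ('b \<Rightarrow> 'a) \<Rightarrow> ('b \<Rightarrow> 'a) \<Rightarrow> nat \<Rightarrow> 'a set \<Rightarrow> bool" where
  "tight V A t h l S \<longleftrightarrow> S \<noteq> {} \<and> S \<subset> V \<and> indeg A t h S = l"

definition nested_exit :: "'a set \<Rightarrow> 'b set \<Rightarrow> ('b \<Rightarrow> 'a) \<Rightarrow> ('b \<Rightarrow> 'a) \<Rightarrow> 'b set \<Rightarrow> nat \<Rightarrow>
    'a set \<Rightarrow> 'a set \<Rightarrow> bool" where
  "nested_exit V A t h F l X U \<longleftrightarrow> tight V A t h l X \<and> tight V A h t l U \<and> U \<subseteq> X
    \<and> (\<exists>e\<in>F. t e \<in> U \<and> h e \<notin> X)"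

text \<open>
  In this locale \<open>l\<close> plays the role of \<open>\<lambda>(D)\<close> and \<open>g\<close> that of \<open>k - \<lambda>(D)\<close>. Its
  assumptions are contradictory. They are invariant under exchanging \<open>t\<close> and \<open>h\<close>, which turns
  tight sets into their complements.
\<close>
locale tight_cover =
  fixes V :: "'a set" and A :: "'b set" and t h :: "'b \<Rightarrow> 'a" and F :: "'b set" and l g :: nat
  assumes finite_V: "finite V" and finite_A: "finite A"
    and tail_in: "e \<in> A \<Longrightarrow> t e \<in> V" and head_in: "e \<in> A \<Longrightarrow> h e \<in> V"
    and F_subset: "F \<subseteq> A"
    and cut: "S \<noteq> {} \<Longrightarrow> S \<subset> V \<Longrightarrow> l \<le> indeg A t h S"
    and surplus: "tight V A t h l S \<Longrightarrow> indeg F t h S + g \<le> indeg F h t S"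
    and covered: "e \<in> F \<Longrightarrow> \<exists>S. tight V A t h l S \<and> t e \<notin> S \<and> h e \<in> S"
    and l_le: "l \<le> g + 1" and g_pos: "0 < g"
begin

abbreviation "source \<equiv> tight V A t h l"
abbreviation "sink \<equiv> tight V A h t l"

lemma finite_F: "finite F"
  using F_subset finite_A finite_subset by blast

lemma indeg_compl: "B \<subseteq> A \<Longrightarrow> indeg B h t (V - S) = indeg B t h S"
  unfolding indeg_def using tail_in head_in by (intro arg_cong[of _ _ card]) blast

lemma indeg_compl': "B \<subseteq> A \<Longrightarrow> indeg B t h (V - S) = indeg B h t S"
  unfolding indeg_def using tail_in head_in by (intro arg_cong[of _ _ card]) blast

lemma sink_compl: "source S \<Longrightarrow> sink (V - S)"
  by (auto simp: tight_def indeg_compl)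

lemma source_compl: "sink S \<Longrightarrow> source (V - S)"
  by (auto simp: tight_def indeg_compl')

lemma swap: "tight_cover V A h t F l g"
proof
  show "l \<le> indeg A h t S" if "S \<noteq> {}" "S \<subset> V" for S
    using cut[of "V - S"] that by (auto simp: indeg_compl')
  show "indeg F h t S + g \<le> indeg F t h S" if "sink S" for S
    using surplus[OF source_compl[OF that]] F_subset by (simp add: indeg_compl indeg_compl')
  show "\<exists>S. sink S \<and> h e \<notin> S \<and> t e \<in> S" if "e \<in> F" for e
    using covered[OF that] sink_compl tail_in F_subset that by blast
qed (use finite_V finite_A tail_in head_in F_subset l_le g_pos in auto)

lemmas sink_surplus = tight_cover.surplus[OF swap]

lemma finite_tight: "finite {S. tight V B p q n S \<and> P S}"
  by (rule finite_subset[of _ "Pow V"]) (use finite_V in \<open>auto simp: tight_def\<close>)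

text \<open>Intersection and union are themselves cuts of in-degree at least \<open>l\<close>, so
  the counting identity has no slack left for arcs between \<open>X - Y\<close> and
  \<open>Y - X\<close>.\<close>

lemma source_uncross:
  assumes "source X" "source Y" "X \<inter> Y \<noteq> {}" "X \<union> Y \<noteq> V"
  shows "source (X \<inter> Y)" "source (X \<union> Y)"
    "e \<in> A \<Longrightarrow> t e \<in> X - Y \<Longrightarrow> h e \<notin> Y - X"
proof -
  let ?E = "{e \<in> A. t e \<in> X - Y \<and> h e \<in> Y - X \<or> t e \<in> Y - X \<and> h e \<in> X - Y}"
  have sub: "X \<inter> Y \<subset> V" "X \<union> Y \<subset> V" "X \<union> Y \<noteq> {}"
    using assms by (auto simp: tight_def)
  have "l \<le> indeg A t h (X \<inter> Y)" "l \<le> indeg A t h (X \<union> Y)"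
    using cut assms(3) sub by simp_all
  moreover have "indeg A t h X = l" "indeg A t h Y = l"
    using assms by (auto simp: tight_def)
  moreover note indeg_Int_Un[OF finite_A, of t h X Y]
  ultimately have *: "indeg A t h (X \<inter> Y) = l" "indeg A t h (X \<union> Y) = l" "card ?E = 0"
    by linarith+
  show "source (X \<inter> Y)" "source (X \<union> Y)"
    using * sub assms(3) by (auto simp: tight_def)
  have "?E = {}" using *(3) finite_A by simp
  then show "e \<in> A \<Longrightarrow> t e \<in> X - Y \<Longrightarrow> h e \<notin> Y - X" by blast
qed

lemmas sink_uncross = tight_cover.source_uncross[OF swap]

lemma source_not_sink: "source X \<Longrightarrow> \<not> sink X"
  using surplus[of X] sink_surplus[of X] g_pos by linarith

text \<open>\<open>X - W\<close> is the complement of the union of the sinks \<open>W\<close> and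
  \<open>V - X\<close>. These meet, as \<open>W\<close> sticks out of \<open>X\<close>, and their
  union misses \<open>X - W\<close>, so they uncross.\<close>

lemma source_Diff_sink:
  assumes "source X" "sink W" "\<not> W \<subseteq> X" "X - W \<noteq> {}"
  shows "source (X - W)"
proof -
  have "sink (W \<union> (V - X))"
    by (rule sink_uncross(2)[OF assms(2) sink_compl[OF assms(1)]])
      (use assms in \<open>auto simp: tight_def\<close>)
  then have "source (V - (W \<union> (V - X)))" by (rule source_compl)
  moreover have "V - (W \<union> (V - X)) = X - W" using assms(1) by (auto simp: tight_def)
  ultimately show ?thesis by simp
qed

section \<open>Excluding nested exits\<close>

lemma leaving_source:
  assumes "source X" "e \<in> F" "t e \<in> X" "h e \<notin> X" "\<And>U. \<not> nested_exit V A t h F l X U"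
  obtains Z where "source Z" "h e \<in> Z" "X \<inter> Z = {}"
proof -
  obtain Z where Z: "source Z" "t e \<notin> Z" "h e \<in> Z" using covered assms(2) by blast
  have e: "e \<in> A" using assms(2) F_subset by blast
  \<comment> \<open>Otherwise uncrossing forbids arcs from \<open>X - Z\<close> to
    \<open>Z - X\<close>, but \<open>e\<close> is one.\<close>
  have "X \<inter> Z = {} \<or> X \<union> Z = V"
    using source_uncross(3)[OF assms(1) Z(1) _ _ e] assms(3,4) Z(2,3) by blast
  moreover have "X \<union> Z \<noteq> V"
  proof
    assume "X \<union> Z = V"
    then have "nested_exit V A t h F l X (V - Z)"
      using assms(1-4) Z sink_compl tail_in[OF e] by (auto simp: nested_exit_def)
    then show False using assms(5) by blast
  qed
  ultimately show ?thesis using that Z by blast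
qed

lemma no_minimal_nested_exit:
  assumes min: "\<And>X' U. card X' < card X \<Longrightarrow> \<not> nested_exit V A t h F l X' U"
    and min': "\<And>X' U. card X' < card X \<Longrightarrow> \<not> nested_exit V A h t F l X' U"
  shows "\<not> nested_exit V A t h F l X U"
proof
  assume "nested_exit V A t h F l X U"
  then obtain e0 where X: "source X" and U: "sink U" "U \<subseteq> X"
    and e0: "e0 \<in> F" "t e0 \<in> U" "h e0 \<notin> X"
    by (auto simp: nested_exit_def)
  have finX: "finite X" "X \<subset> V"
    using X finite_V finite_subset by (auto simp: tight_def)
  have stuck: False if "source X'" "X' \<subset> X" "sink W" "W \<subseteq> X'" "e \<in> F" "t e \<in> W" "h e \<notin> X'"
    for X' W e
    using min[of X' W] psubset_card_mono[OF finX(1) that(2)] that by (auto simp: nested_exit_def)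
  define T where "T = {W. sink W \<and> W \<subseteq> X}"
  \<comment> \<open>\<open>R\<close> is closed under \<open>F\<close>-predecessors: were an \<open>F\<close>-arc to lead from \<open>W'\<close> to \<open>W \<in> R\<close> with \<open>W'\<close> in
    a smaller source \<open>X'\<close>, then \<open>X'\<close> or \<open>X' - W\<close> would contradict the minimality of \<open>X\<close>.\<close>
  define R where
    "R = {W \<in> maximal_sets T. \<forall>X'. source X' \<longrightarrow> W \<subseteq> X' \<longrightarrow> X' \<subseteq> X \<longrightarrow> X' = X}"
  have finT: "finite T" unfolding T_def by (rule finite_tight)
  have disjT: "disjoint (maximal_sets T)"
  proof (rule maximal_sets_disjoint)
    fix S S' assume S: "S \<in> T" "S' \<in> T" "S \<inter> S' \<noteq> {}"
    then have "S \<union> S' \<noteq> V" using finX by (auto simp: T_def)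
    then show "S \<union> S' \<in> T" using S sink_uncross(2) by (auto simp: T_def)
  qed
  have R: "sink W" "W \<subseteq> X" "W \<in> maximal_sets T" if "W \<in> R" for W
    using that by (auto simp: R_def T_def maximal_sets_def)
  obtain U1 where U1: "U1 \<in> maximal_sets T" "U \<subseteq> U1"
    using maximal_sets_exist[OF finT, of U] U by (auto simp: T_def)
  have U1': "sink U1" "U1 \<subseteq> X" using U1(1) by (auto simp: T_def maximal_sets_def)
  \<comment> \<open>A smaller source around \<open>U1\<close> would also be left by
    \<open>e0\<close>, against minimality.\<close>
  have "U1 \<in> R"
    unfolding R_def using U1 stuck[OF _ _ U1'(1) _ e0(1)] e0 by blast
  have pred: "W' \<in> R" if W: "W \<in> R" and W': "W' \<in> maximal_sets T" "W \<noteq> W'"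
    and e: "e \<in> F" "t e \<in> W'" "h e \<in> W" for W W' e
  proof (rule ccontr)
    assume "W' \<notin> R"
    then obtain X' where X': "source X'" "W' \<subseteq> X'" "X' \<subset> X"
      using W'(1) by (auto simp: R_def)
    have sW': "sink W'" using W'(1) by (auto simp: T_def maximal_sets_def)
    have disj: "W \<inter> W' = {}"
      using disjT R(3)[OF W] W' by (auto simp: disjoint_def)
    have "\<not> W \<subseteq> X'" using W X' by (auto simp: R_def)
    then have "source (X' - W)"
      using source_Diff_sink[OF X'(1) R(1)[OF W]] X'(2) disj e(2) by blast
    then show False
      using stuck[of "X' - W" W' e] X' sW' disj e by blast
  qed
  \<comment> \<open>Otherwise the dual of \<open>leaving_source\<close> puts \<open>t e\<close> in a
    sink \<open>Z\<close> disjoint from \<open>W\<close>. If \<open>Z\<close> lies in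
    \<open>X\<close>, then \<open>pred\<close> places it below a member of \<open>R\<close>; if not,
    \<open>X - Z\<close> is a smaller source around \<open>W\<close>.\<close>
  have enter: "t e \<notin> X" if e: "e \<in> F" "h e \<in> \<Union>R" "t e \<notin> \<Union>R" for e
  proof
    assume teX: "t e \<in> X"
    obtain W where W: "W \<in> R" "h e \<in> W" using e(2) by blast
    have "W \<noteq> X" using source_not_sink R(1)[OF W(1)] X by blast
    then have "card W < card X"
      using R(2)[OF W(1)] finX(1) by (simp add: psubsetI psubset_card_mono)
    then have "\<not> nested_exit V A h t F l W Z" for Z using min' by blast
    then obtain Z where Z: "sink Z" "t e \<in> Z" "W \<inter> Z = {}"
      using tight_cover.leaving_source[OF swap R(1)[OF W(1)] e(1) W(2)] e(3) W(1) by blast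
    show False
    proof (cases "Z \<subseteq> X")
      case True
      then obtain W' where W': "W' \<in> maximal_sets T" "Z \<subseteq> W'"
        using maximal_sets_exist[OF finT, of Z] Z by (auto simp: T_def)
      then have "W' \<in> R" using pred[OF W(1) W'(1) _ e(1)] W Z e(3) by blast
      then show False using W' Z e(3) by blast
    next
      case False
      have "source (X - Z)"
        using source_Diff_sink[OF X Z(1) False] Z(3) R(2)[OF W(1)] W(2) by blast
      moreover have "W \<subseteq> X - Z" using Z(3) R(2)[OF W(1)] by blast
      ultimately have "X - Z = X" using W(1) unfolding R_def by blast
      then show False using Z teX by blast
    qed
  qed
  define a where "a = card {e \<in> F. t e \<notin> X \<and> h e \<in> \<Union>R}"
  define s where "s = card {e \<in> F. t e \<in> \<Union>R \<and> h e \<notin> X}"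
  have RX: "\<Union>R \<subseteq> X" using R(2) by blast
  have finR: "finite R" using finT by (auto simp: R_def maximal_sets_def)
  have "indeg F h t (\<Union>R) + card R * g \<le> indeg F t h (\<Union>R)"
    by (rule indeg_Union_surplus[OF finite_F finR])
      (use R(1) sink_surplus disjT in \<open>auto simp: R_def disjoint_def\<close>)
  moreover have "indeg F t h (\<Union>R) \<le> a"
    unfolding a_def indeg_def by (rule card_mono) (use finite_F enter in auto)
  moreover have "s \<le> indeg F h t (\<Union>R)"
    unfolding s_def indeg_def by (rule card_mono) (use finite_F RX in auto)
  ultimately have as: "s + card R * g \<le> a" by linarith
  have "a \<le> indeg A t h X"
    unfolding a_def indeg_def by (rule card_mono) (use finite_A F_subset RX in auto)
  then have al: "a \<le> l" using X by (simp add: tight_def)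
  have "e0 \<in> {e \<in> F. t e \<in> \<Union>R \<and> h e \<notin> X}"
    using e0 U1(2) \<open>U1 \<in> R\<close> by blast
  then have s: "0 < s" unfolding s_def using finite_F card_gt_0_iff by fastforce
  \<comment> \<open>For \<open>card R = 1\<close> the cut \<open>X - U1\<close> gives
    \<open>a + s \<le> l\<close>, hence \<open>2 * s + g \<le> g + 1\<close>. For larger
    \<open>R\<close>, \<open>s + 2 * g \<le> a \<le> l \<le> g + 1\<close>. Both fail as
    \<open>s\<close> and \<open>g\<close> are positive.\<close>
  show False
  proof (cases "card R = 1")
    case True
    then have UR: "\<Union>R = U1" using \<open>U1 \<in> R\<close> by (auto simp: card_1_singleton_iff)
    have "U1 \<noteq> X" using source_not_sink[OF X] U1'(1) by metis
    then have "X - U1 \<noteq> {}" using U1'(2) by blast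
    then have "l \<le> indeg A t h (X - U1)" using cut[of "X - U1"] finX by blast
    moreover have "indeg A t h X = l" "indeg A h t U1 = l"
      using X U1'(1) by (auto simp: tight_def)
    moreover note indeg_Diff[OF finite_A U1'(2), of t h]
    moreover have "a \<le> card {e \<in> A. t e \<notin> X \<and> h e \<in> U1}"
      unfolding a_def UR by (rule card_mono) (use finite_A F_subset in auto)
    moreover have "s \<le> card {e \<in> A. t e \<in> U1 \<and> h e \<notin> X}"
      unfolding s_def UR by (rule card_mono) (use finite_A F_subset in auto)
    ultimately have "a + s \<le> l" by linarith
    then show False using as s l_le True by simp
  next
    case False
    moreover have "card R \<noteq> 0" using \<open>U1 \<in> R\<close> finR by auto
    ultimately have "2 * g \<le> card R * g" by (intro mult_le_mono1) linarith
    then show False using as al s l_le g_pos by linarith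
  qed
qed

text \<open>Each orientation needs minimality in the other one, so a single induction on size treats
  both.\<close>

lemma no_nested_exit:
  "\<not> nested_exit V A t h F l X U \<and> \<not> nested_exit V A h t F l X U"
proof (induction "card X" arbitrary: X U rule: less_induct)
  case less
  have "\<not> nested_exit V A t h F l X' U'" "\<not> nested_exit V A h t F l X' U'"
    if "card X' < card X" for X' U'
    using less[OF that] by simp_all
  then show ?case
    using no_minimal_nested_exit tight_cover.no_minimal_nested_exit[OF swap] by simp
qed

lemma no_source: "\<not> source S"
proof
  assume "source S"
  then have fin: "finite {S. source S}" "S \<in> {S. source S}"
    using finite_tight[of A t h l "\<lambda>_. True"] by simp_all
  obtain M where M: "M \<in> maximal_sets {S. source S}"
    using maximal_sets_exist[OF fin] by blast
  then have sM: "source M" by (simp add: maximal_sets_def)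
  \<comment> \<open>Unions of sources avoiding \<open>M\<close> are never \<open>V\<close>, so
    overlapping ones merge. A source that meets \<open>M\<close> but misses some other member of the
    family below is absorbed by the maximal \<open>M\<close>.\<close>
  define T where "T = {S. source S \<and> S \<inter> M = {}}"
  have finT: "finite T" unfolding T_def by (rule finite_tight)
  have disjT: "disjoint (maximal_sets T)"
  proof (rule maximal_sets_disjoint)
    fix S S' assume S: "S \<in> T" "S' \<in> T" "S \<inter> S' \<noteq> {}"
    then have "S \<union> S' \<noteq> V" using sM by (auto simp: T_def tight_def)
    then show "S \<union> S' \<in> T" using S source_uncross(2) by (auto simp: T_def)
  qed
  define R where "R = insert M (maximal_sets T)"
  have finR: "finite R" using finT by (auto simp: R_def maximal_sets_def)
  have R: "source X" if "X \<in> R" for X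
    using that sM by (auto simp: R_def T_def maximal_sets_def)
  have "S \<inter> M = {}" if "S \<in> maximal_sets T" for S
    using that by (simp add: maximal_sets_def T_def)
  then have disjR: "disjoint R"
    using disjT unfolding R_def disjoint_def by (simp add: Int_commute)
  have below: "Z \<subseteq> \<Union>R" if "Z \<in> T" for Z
    using maximal_sets_exist[OF finT that] by (auto simp: R_def)
  have "h e \<in> \<Union>R" if e: "e \<in> F" "t e \<in> \<Union>R" for e
  proof (rule ccontr)
    assume he: "h e \<notin> \<Union>R"
    obtain X where X: "X \<in> R" "t e \<in> X" using e(2) by blast
    obtain Z where Z: "source Z" "h e \<in> Z" "X \<inter> Z = {}"
      using leaving_source[OF R[OF X(1)] e(1) X(2)] no_nested_exit he X(1) by blast
    show False
    proof (cases "Z \<inter> M = {}")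
      case True
      then show False using below[of Z] Z he by (auto simp: T_def)
    next
      case False
      then have "X \<noteq> M" using Z(3) by blast
      then have "X \<inter> M = {}" using X(1) disjR by (auto simp: R_def disjoint_def)
      moreover have "X \<noteq> {}" "X \<subseteq> V" using R[OF X(1)] by (auto simp: tight_def)
      ultimately have "source (Z \<union> M)"
        using source_uncross(2)[OF Z(1) sM False] Z(3) by blast
      then have "Z \<union> M = M" using M by (auto simp: maximal_sets_def)
      then show False using Z he by (auto simp: R_def)
    qed
  qed
  then have "indeg F h t (\<Union>R) = 0"
    using indeg_pos_iff[OF finite_F, of h t "\<Union>R"] by blast
  moreover have "indeg F t h (\<Union>R) + card R * g \<le> indeg F h t (\<Union>R)"
    by (rule indeg_Union_surplus[OF finite_F finR disjR]) (use R surplus in auto)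
  moreover have "card R \<noteq> 0" using finR by (auto simp: R_def)
  ultimately show False using g_pos by simp
qed

end

section \<open>Arc-connectivity and arc reversal\<close>

lemma arc_connectivity_ge_iff:
  "enat n \<le> arc_connectivity D \<longleftrightarrow> (\<forall>X. X \<noteq> {} \<and> X \<subset> verts D \<longrightarrow> n \<le> set_in_degree D X)"
  by (auto simp: arc_connectivity_def le_INF_iff)

lemma arc_connectivity_attained:
  assumes "arc_connectivity D = enat n"
  obtains X where "X \<noteq> {}" "X \<subset> verts D" "set_in_degree D X = n"
proof -
  have "\<not> enat (Suc n) \<le> arc_connectivity D" using assms by simp
  then obtain X where X: "X \<noteq> {}" "X \<subset> verts D" "\<not> Suc n \<le> set_in_degree D X"
    unfolding arc_connectivity_ge_iff by blast
  moreover have "n \<le> set_in_degree D X"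
    using X(1,2) arc_connectivity_ge_iff[of n D] assms by simp
  ultimately have "set_in_degree D X = n" by linarith
  with X(1,2) show ?thesis by (rule that)
qed

lemma set_in_degree_reverse_arcs:
  assumes "finite (arcs D)" and "F \<subseteq> arcs D"
  shows "set_in_degree (reverse_arcs D F) X + indeg F (tail D) (head D) X
    = set_in_degree D X + indeg F (head D) (tail D) X"
proof -
  have F: "{e \<in> F. P e} = {e \<in> arcs D. e \<in> F \<and> P e}" for P using assms(2) by blast
  have "set_in_degree (reverse_arcs D F) X = card {e \<in> arcs D.
      (if e \<in> F then head D e else tail D e) \<notin> X \<and> (if e \<in> F then tail D e else head D e) \<in> X}"
    by (simp add: set_in_degree_def entering_arcs_def reverse_arcs_def)
  then show ?thesis
    unfolding set_in_degree_def entering_arcs_def indeg_def F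
    by (simp only: card_filter_eq_sum[OF assms(1)] sum.distrib[symmetric])
      (rule sum.cong, auto)
qed

theorem theorem8:
  fixes D :: "('a, 'b) pre_digraph" and k :: nat and F :: "'b set"
  assumes "fin_digraph D"
    and "k \<ge> 2"
    and "F \<subseteq> arcs D"
    and "arc_connectivity D \<le> enat ((k + 1) div 2)"
    and "arc_connected k (reverse_arcs D F)"
  shows "\<exists>a\<in>F. arc_connectivity D \<le> arc_connectivity (reverse_arcs D {a})"
proof (rule ccontr)
  assume neg: "\<not> ?thesis"
  interpret fin_digraph D by fact
  have fin: "finite (arcs D)" by simp
  obtain l where l: "arc_connectivity D = enat l" "l \<le> (k + 1) div 2"
    using assms(4) by (cases "arc_connectivity D") auto
  have cut: "l \<le> set_in_degree D S" if "S \<noteq> {}" "S \<subset> verts D" for S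
    using arc_connectivity_ge_iff[of l D] l that by simp
  have rev: "k \<le> set_in_degree (reverse_arcs D F) S" if "S \<noteq> {}" "S \<subset> verts D" for S
    using assms(5) that unfolding arc_connected_def arc_connectivity_ge_iff
    by (simp add: reverse_arcs_def)
  have deg: "set_in_degree D = indeg (arcs D) (tail D) (head D)"
    by (simp add: fun_eq_iff set_in_degree_def entering_arcs_def indeg_def)
  \<comment> \<open>The bound \<open>l \<le> (k + 1) div 2\<close> yields
    \<open>l \<le> (k - l) + 1\<close>, and together with \<open>k \<ge> 2\<close> also
    \<open>0 < k - l\<close>.\<close>
  have "tight_cover (verts D) (arcs D) (tail D) (head D) F l (k - l)"
  proof
    fix S assume S: "tight (verts D) (arcs D) (tail D) (head D) l S"
    then show "indeg F (tail D) (head D) S + (k - l) \<le> indeg F (head D) (tail D) S"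
      using rev[of S] set_in_degree_reverse_arcs[OF fin assms(3), of S] l(2)
      unfolding tight_def deg by linarith
  next
    fix e assume e: "e \<in> F"
    then have "\<not> enat l \<le> arc_connectivity (reverse_arcs D {e})" using neg l by auto
    then obtain S where S: "S \<noteq> {}" "S \<subset> verts D" "set_in_degree (reverse_arcs D {e}) S < l"
      unfolding arc_connectivity_ge_iff by (auto simp: reverse_arcs_def not_le)
    have "set_in_degree (reverse_arcs D {e}) S + indeg {e} (tail D) (head D) S
        = set_in_degree D S + indeg {e} (head D) (tail D) S"
      using set_in_degree_reverse_arcs[OF fin, of "{e}" S] e assms(3) by auto
    moreover have "indeg {e} (tail D) (head D) S \<le> 1"
      unfolding indeg_def using card_mono[of "{e}" "{x \<in> {e}. tail D x \<notin> S \<and> head D x \<in> S}"]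
      by auto
    moreover note cut[OF S(1,2)] S(3)
    \<comment> \<open>One reversal lowers an in-degree by at most 1, so falling below
      \<open>l\<close> requires a tight set that \<open>e\<close> enters.\<close>
    ultimately have "set_in_degree D S = l" "0 < indeg {e} (tail D) (head D) S" by linarith+
    then show "\<exists>S. tight (verts D) (arcs D) (tail D) (head D) l S \<and> tail D e \<notin> S \<and> head D e \<in> S"
      using S by (auto simp: tight_def deg indeg_pos_iff)
  qed (use assms(2,3) l(2) cut deg in auto)
  then have "\<not> tight (verts D) (arcs D) (tail D) (head D) l S" for S
    by (rule tight_cover.no_source)
  moreover obtain X where "X \<noteq> {}" "X \<subset> verts D" "set_in_degree D X = l"
    using arc_connectivity_attained[OF l(1)] .
  ultimately show False unfolding tight_def deg by blast
qed

end
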